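(* Assume $1<|\mathcal X|<|\mathcal Y|$ and $\mathcal W_\kappa(\mathcal Y,\mathcal E)\neq\emptyset$. If $(\mathcal Y,\mathcal E)$ has no multi-row merging block with respect to $\kappa$, then $\mathcal W_\kappa(\mathcal Y,\mathcal E)$ forms an e-family.
   Context: Let $\mathcal Y$ be a finite set and $\mathcal E\subset\mathcal Y^2$ a nonempty edge set such that the digraph $(\mathcal Y,\mathcal E)$ is strongly connected. $\mathcal F(\mathcal Y,\mathcal E)=\mathbb R^{\mathcal E}$ is the space of real functions on $\mathcal E$, identified with real $\mathcal Y\times\mathcal Y$ matrices vanishing outside $\mathcal E$; $\mathcal F^+(\mathcal Y,\mathcal E)$ is the subset of those that are strictly positive on $\mathcal E$; $\mathcal W(\mathcal Y,\mathcal E)\subset\mathcal F^+(\mathcal Y,\mathcal E)$ is the set of row-stochastic ones. Let $\kappa\colon\mathcal Y\to\mathcal X$ be surjective, $\mathcal S_x=\kappa^{-1}(x)$, $\mathcal D=\{(\kappa(y),\kappa(y')):(y,y')\in\mathcal E\}$, and write $F(y,\mathcal S_{x'})=\sum_{y'\in\mathcal S_{x'}}F(y,y')$. $\mathcal W_\kappa(\mathcal Y,\mathcal E)$ is the set of $\kappa$-lumpable $P\in\mathcal W(\mathcal Y,\mathcal E)$, i.e. those with $P(y_1,\mathcal S_{x'})=P(y_2,\mathcal S_{x'})$ for all $(x,x')\in\mathcal D$ and $y_1,y_2\in\mathcal S_x$. Merging blocks: $(x,x')\in\mathcal D$ is a merging block of $(\mathcal Y,\mathcal E)$ with respect to $\kappa$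 if for some $y\in\mathcal S_x$ one has $|\{(y,y')\in\mathcal E: y'\in\mathcal S_{x'}\}|>1$; it is multi-row if moreover $|\mathcal S_x|\ge 2$. E-families: for $F\in\mathcal F^+(\mathcal Y,\mathcal E)$ with Perron–Frobenius root $\rho_F$ and positive right eigenvector $v_F$, put $\mathfrak s(F)(y,y')=\frac{F(y,y')v_F(y')}{\rho_F v_F(y)}$, so $\mathfrak s(F)\in\mathcal W(\mathcal Y,\mathcal E)$. Let $\mathcal N(\mathcal Y,\mathcal E)$ be the linear space of $N\in\mathcal F(\mathcal Y,\mathcal E)$ of the form $N(y,y')=f(y')-f(y)+c$ with $f\in\mathbb R^{\mathcal Y}$, $c\in\mathbb R$. A set $\mathcal V\subset\mathcal W(\mathcal Y,\mathcal E)$ forms an e-family (of dimension $d\ge 0$) if there are $K\in\mathcal F(\mathcal Y,\mathcal E)$ and $G_1,\dots,G_d\in\mathcal F(\mathcal Y,\mathcal E)$, linearly independent modulo $\mathcal N(\mathcal Y,\mathcal E)$, with $\mathcal V=\{\mathfrak s(\exp(K+\sum_{i=1}^d\theta^iG_i)):\theta\in\mathbb R^d\}$, where $\exp$ is applied entrywise on $\mathcal E$. *)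

theory Defs
  imports "HOL-Analysis.Analysis"
begin

text \<open>The finite set of states is the universe of a finite type. A real function on the edge set
  \<open>E\<close> is a square matrix that vanishes outside \<open>E\<close>.\<close>

definition strongly_connected :: "('y \<times> 'y) set \<Rightarrow> bool" where
  "strongly_connected E \<longleftrightarrow> (\<forall>y y'. (y, y') \<in> E\<^sup>*)"

definition edge_funs :: "('y::finite \<times> 'y) set \<Rightarrow> (real ^ 'y ^ 'y) set" where
  "edge_funs E = {F. \<forall>y y'. (y, y') \<notin> E \<longrightarrow> F $ y $ y' = 0}"

definition pos_edge_funs :: "('y::finite \<times> 'y) set \<Rightarrow> (real ^ 'y ^ 'y) set" where
  "pos_edge_funs E = {F \<in> edge_funs E. \<forall>(y, y') \<in> E. F $ y $ y' > 0}"

definition stochastic_funs :: "('y::finite \<times> 'y) set \<Rightarrow> (real ^ 'y ^ 'y) set" where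
  "stochastic_funs E = {P \<in> pos_edge_funs E. \<forall>y. (\<Sum>y'\<in>UNIV. P $ y $ y') = 1}"


definition fibre :: "('y \<Rightarrow> 'x) \<Rightarrow> 'x \<Rightarrow> 'y set" where
  "fibre \<kappa> x = \<kappa> -` {x}"

definition lumped_edges :: "('y \<times> 'y) set \<Rightarrow> ('y \<Rightarrow> 'x) \<Rightarrow> ('x \<times> 'x) set" where
  "lumped_edges E \<kappa> = {(\<kappa> y, \<kappa> y') | y y'. (y, y') \<in> E}"

definition row_mass :: "real ^ 'y ^ 'y \<Rightarrow> 'y::finite \<Rightarrow> 'y set \<Rightarrow> real" where
  "row_mass F y S = (\<Sum>y'\<in>S. F $ y $ y')"

definition lumpable_funs ::
  "('y::finite \<times> 'y) set \<Rightarrow> ('y \<Rightarrow> 'x) \<Rightarrow> (real ^ 'y ^ 'y) set" where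
  "lumpable_funs E \<kappa> = {P \<in> stochastic_funs E.
     \<forall>(x, x') \<in> lumped_edges E \<kappa>. \<forall>y1 \<in> fibre \<kappa> x. \<forall>y2 \<in> fibre \<kappa> x.
       row_mass P y1 (fibre \<kappa> x') = row_mass P y2 (fibre \<kappa> x')}"

definition merging_block ::
  "('y::finite \<times> 'y) set \<Rightarrow> ('y \<Rightarrow> 'x) \<Rightarrow> 'x \<times> 'x \<Rightarrow> bool" where
  "merging_block E \<kappa> = (\<lambda>(x, x'). (x, x') \<in> lumped_edges E \<kappa> \<and>
     (\<exists>y \<in> fibre \<kappa> x. card {(z, z') \<in> E. z = y \<and> z' \<in> fibre \<kappa> x'} > 1))"

definition multi_row_merging_block ::
  "('y::finite \<times> 'y) set \<Rightarrow> ('y \<Rightarrow> 'x) \<Rightarrow> 'x \<times> 'x \<Rightarrow> bool" where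
  "multi_row_merging_block E \<kappa> = (\<lambda>(x, x').
     merging_block E \<kappa> (x, x') \<and> card (fibre \<kappa> x) \<ge> 2)"


definition complex_eigenvalue :: "real ^ 'y ^ 'y \<Rightarrow> complex \<Rightarrow> bool" where
  "complex_eigenvalue F \<mu> \<longleftrightarrow>
     (\<exists>u :: complex ^ 'y::finite. u \<noteq> 0 \<and>
        (\<chi> y y'. complex_of_real (F $ y $ y')) *v u = \<mu> *s u)"

text \<open>The Perron--Frobenius root is the spectral radius.\<close>

definition pf_root :: "real ^ 'y ^ 'y::finite \<Rightarrow> real" where
  "pf_root F = Sup {cmod \<mu> | \<mu>. complex_eigenvalue F \<mu>}"

text \<open>For \<open>F \<in> pos_edge_funs E\<close> with \<open>E\<close> nonempty and strongly connected, the positive right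
  eigenvector exists and is unique up to a positive factor. The matrix \<open>stoch F\<close> does not depend
  on this factor.\<close>

definition pf_vector :: "real ^ 'y ^ 'y::finite \<Rightarrow> real ^ 'y" where
  "pf_vector F = (SOME v. (\<forall>y. v $ y > 0) \<and> F *v v = pf_root F *s v)"

definition stoch :: "real ^ 'y ^ 'y::finite \<Rightarrow> real ^ 'y ^ 'y" where
  "stoch F = (\<chi> y y'. F $ y $ y' * pf_vector F $ y' / (pf_root F * pf_vector F $ y))"

definition exp_on :: "('y::finite \<times> 'y) set \<Rightarrow> real ^ 'y ^ 'y \<Rightarrow> real ^ 'y ^ 'y" where
  "exp_on E F = (\<chi> y y'. if (y, y') \<in> E then exp (F $ y $ y') else 0)"

definition null_space :: "('y::finite \<times> 'y) set \<Rightarrow> (real ^ 'y ^ 'y) set" where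
  "null_space E = {N \<in> edge_funs E.
     \<exists>f :: 'y \<Rightarrow> real. \<exists>c. \<forall>(y, y') \<in> E. N $ y $ y' = f y' - f y + c}"

definition independent_mod_null ::
  "('y::finite \<times> 'y) set \<Rightarrow> nat \<Rightarrow> (nat \<Rightarrow> real ^ 'y ^ 'y) \<Rightarrow> bool" where
  "independent_mod_null E d G \<longleftrightarrow>
     (\<forall>a :: nat \<Rightarrow> real. (\<Sum>i=1..d. a i *\<^sub>R G i) \<in> null_space E \<longrightarrow> (\<forall>i\<in>{1..d}. a i = 0))"

definition e_family_of_dim ::
  "('y::finite \<times> 'y) set \<Rightarrow> nat \<Rightarrow> (real ^ 'y ^ 'y) set \<Rightarrow> bool" where
  "e_family_of_dim E d V \<longleftrightarrow> V \<subseteq> stochastic_funs E \<and>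
     (\<exists>K \<in> edge_funs E. \<exists>G. (\<forall>i\<in>{1..d}. G i \<in> edge_funs E) \<and> independent_mod_null E d G \<and>
        V = {stoch (exp_on E (K + (\<Sum>i=1..d. \<theta> i *\<^sub>R G i))) | \<theta> :: nat \<Rightarrow> real. True})"

definition e_family :: "('y::finite \<times> 'y) set \<Rightarrow> (real ^ 'y ^ 'y) set \<Rightarrow> bool" where
  "e_family E V \<longleftrightarrow> (\<exists>d. e_family_of_dim E d V)"

end

theory Submission
  imports Defs
begin

text \<open>Without multi-row merging blocks, two distinct states of one fibre have exactly one edge each
  into every fibre that they reach, so row masses on such fibres are single matrix entries.
  Lumpability therefore says that these entries agree, while a singleton fibre imposes no
  condition at all. The resulting set of matrices, \<open>tied_funs\<close>, is a linear space whose defining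
  equations compare entries two at a time; such equations pass through entrywise logarithms and
  exponentials. As soon as some lumpable chain exists, rows of one fibre reach the same fibres,
  and the lumpable chains are exactly the stochastic tied functions
  (\<open>lumpable_iff_tied\<close>).

  A linear family stays inside the lumpable chains under the normalisation \<open>stoch\<close> because a tied
  positive matrix \<open>F\<close> projects along \<open>\<kappa>\<close> to an irreducible matrix on the lumped states. Its Perron
  vector, composed with \<open>\<kappa>\<close>, is a positive eigenvector of \<open>F\<close>, and hence the Perron vector of
  \<open>F\<close>. The factors by which \<open>stoch\<close> changes the entries of \<open>F\<close> are then constant on
  blocks, so \<open>stoch F\<close> is tied again (\<open>stoch_tied_lumpable\<close>). Conversely a lumpable \<open>P\<close> is its own
  normalisation and is the exponential of a tied matrix.

  So the lumpable chains are the normalised exponentials of a linear space. Directions in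
  \<open>null_space E\<close> do not change the normalisation (\<open>stoch_exp_on_add_null\<close>), and a basis of a
  complement of these directions gives the generators, with \<open>K = 0\<close>.\<close>


section \<open>Positive eigenvectors of irreducible matrices\<close>

definition positive_eigenpair :: "real ^ 'y ^ 'y \<Rightarrow> real \<Rightarrow> real ^ 'y::finite \<Rightarrow> bool" where
  "positive_eigenpair F \<rho> v \<longleftrightarrow> (\<forall>y. v $ y > 0) \<and> F *v v = \<rho> *s v"

lemma positive_eigenpair_iff:
  "positive_eigenpair F \<rho> v \<longleftrightarrow>
     (\<forall>y. v $ y > 0) \<and> (\<forall>y. (\<Sum>y'\<in>UNIV. F $ y $ y' * v $ y') = \<rho> * v $ y)"
  by (simp add: positive_eigenpair_def vec_eq_iff matrix_vector_mult_def)

lemma pos_edge_funs_nonneg: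
  assumes "F \<in> pos_edge_funs E"
  shows "F $ y $ y' \<ge> 0"
  using assms unfolding pos_edge_funs_def edge_funs_def
  by (cases "(y, y') \<in> E") (auto intro: less_imp_le)

lemma pos_edge_funs_pos:
  "F \<in> pos_edge_funs E \<Longrightarrow> (y, y') \<in> E \<Longrightarrow> F $ y $ y' > 0"
  by (auto simp: pos_edge_funs_def)

lemma strongly_connected_succ:
  assumes "E \<noteq> {}" "strongly_connected E"
  shows "\<exists>y'. (y, y') \<in> E"
proof -
  obtain a b where ab: "(a, b) \<in> E" using assms(1) by auto
  have "(y, a) \<in> E\<^sup>*" using assms(2) by (simp add: strongly_connected_def)
  then show ?thesis using ab by (cases rule: converse_rtranclE) auto
qed

lemma strongly_connected_pred:
  assumes "E \<noteq> {}" "strongly_connected E"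
  shows "\<exists>y. (y, y') \<in> E"
proof -
  obtain a b where ab: "(a, b) \<in> E" using assms(1) by auto
  have "(b, y') \<in> E\<^sup>*" using assms(2) by (simp add: strongly_connected_def)
  then show ?thesis using ab by (cases rule: rtranclE) auto
qed

text \<open>If \<open>z\<close> vanishes at \<open>y\<close>, so does \<open>F z\<close>, which is a sum of nonnegative terms; hence \<open>z\<close> vanishes
  at the successors of \<open>y\<close>, and strong connectivity spreads the zero to all states.\<close>

lemma nonneg_eigenvector_zero:
  assumes sc: "strongly_connected E" and F: "F \<in> pos_edge_funs E"
    and nonneg: "\<And>y. z $ y \<ge> 0"
    and eig: "\<And>y. (\<Sum>y'\<in>UNIV. F $ y $ y' * z $ y') = \<rho> * z $ y"
    and zero: "z $ y0 = 0"
  shows "z = 0"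
proof -
  have "z $ y = 0" for y
  proof -
    have "(y0, y) \<in> E\<^sup>*" using sc by (simp add: strongly_connected_def)
    then show ?thesis
    proof (induction rule: rtrancl_induct)
      case base
      show ?case by (rule zero)
    next
      case (step a b)
      have "(\<Sum>y'\<in>UNIV. F $ a $ y' * z $ y') = 0" using eig[of a] step.IH by simp
      then have "F $ a $ b * z $ b = 0"
        using nonneg pos_edge_funs_nonneg[OF F] by (subst (asm) sum_nonneg_eq_0_iff) auto
      then show ?case using pos_edge_funs_pos[OF F step.hyps(2)] by simp
    qed
  qed
  then show ?thesis by (simp add: vec_eq_iff)
qed

text \<open>A fixed point of \<open>u \<mapsto> F u / |F u|\<close> on the probability simplex, which Brouwer's theorem
  provides, is a nonnegative eigenvector, and a zero entry would make it vanish. The map is defined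
  because no column of \<open>F\<close> is zero.\<close>

lemma positive_eigenpair_exists:
  fixes E :: "('y::finite \<times> 'y) set"
  assumes ne: "E \<noteq> {}" and sc: "strongly_connected E" and F: "F \<in> pos_edge_funs E"
  shows "\<exists>\<rho> v. positive_eigenpair F \<rho> v"
proof -
  define S where "S = {u :: real ^ 'y. (\<forall>y. u $ y \<ge> 0) \<and> (\<Sum>y\<in>UNIV. u $ y) = 1}"
  define mass where "mass u = (\<Sum>y\<in>UNIV. (F *v u) $ y)" for u
  define T where "T u = (1 / mass u) *\<^sub>R (F *v u)" for u
  have image_nonneg: "(F *v u) $ y \<ge> 0" if "u \<in> S" for u y
    using that pos_edge_funs_nonneg[OF F]
    by (auto simp: S_def matrix_vector_mult_def intro!: sum_nonneg)
  have mass_pos: "mass u > 0" if "u \<in> S" for u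
  proof -
    have "\<exists>y. u $ y > 0"
    proof (rule ccontr)
      assume "\<not> ?thesis"
      then have "u $ y = 0" for y using that by (auto simp: S_def not_less antisym)
      then show False using that by (simp add: S_def)
    qed
    then obtain b where b: "u $ b > 0" ..
    obtain a where a: "(a, b) \<in> E" using strongly_connected_pred[OF ne sc] by blast
    have "0 < F $ a $ b * u $ b" using b pos_edge_funs_pos[OF F a] by simp
    also have "\<dots> \<le> (F *v u) $ a"
      unfolding matrix_vector_mult_def
      using that pos_edge_funs_nonneg[OF F] by (auto simp: S_def intro!: member_le_sum)
    also have "\<dots> \<le> mass u"
      unfolding mass_def using image_nonneg[OF that] by (intro member_le_sum) auto
    finally show ?thesis .
  qed
  have "closed S"
    unfolding S_def
    by (intro closed_Collect_conj closed_Collect_all closed_Collect_le closed_Collect_eq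
        continuous_intros)
  moreover have "bounded S"
  proof (rule boundedI)
    fix u assume "u \<in> S"
    then have "norm u \<le> (\<Sum>y\<in>UNIV. u $ y)"
      using norm_le_l1_cart[of u] by (simp add: S_def)
    then show "norm u \<le> 1" using \<open>u \<in> S\<close> by (simp add: S_def)
  qed
  ultimately have "compact S" by (simp add: compact_eq_bounded_closed)
  moreover have "convex S"
    unfolding S_def by (auto simp: convex_def sum.distrib sum_distrib_left[symmetric])
  moreover have "S \<noteq> {}"
  proof -
    have "axis undefined 1 \<in> S" by (simp add: S_def axis_def)
    then show ?thesis by auto
  qed
  moreover have "continuous_on S T"
  proof -
    have "mass u \<noteq> 0" if "u \<in> S" for u using mass_pos[OF that] by simp
    then show ?thesis
      unfolding T_def mass_def
      by (intro continuous_intros matrix_vector_mult_linear_continuous_on) auto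
  qed
  moreover have "T \<in> S \<rightarrow> S"
  proof
    fix u assume u: "u \<in> S"
    have "(\<Sum>y\<in>UNIV. T u $ y) = mass u / mass u"
      unfolding T_def by (simp add: mass_def flip: sum_divide_distrib)
    then show "T u \<in> S"
      using mass_pos[OF u] image_nonneg[OF u] by (simp add: S_def T_def)
  qed
  ultimately obtain v where v: "v \<in> S" "T v = v" by (rule brouwer)
  have "F *v v = mass v *\<^sub>R T v" using mass_pos[OF v(1)] by (simp add: T_def)
  then have "F *v v = mass v *s v" using v(2) by (simp add: scalar_mult_eq_scaleR)
  then have eig: "(\<Sum>y'\<in>UNIV. F $ y $ y' * v $ y') = mass v * v $ y" for y
    by (simp add: vec_eq_iff matrix_vector_mult_def)
  have nonneg: "v $ y \<ge> 0" for y using v(1) by (simp add: S_def)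
  have "v \<noteq> 0" using v(1) by (auto simp: S_def)
  then have "v $ y > 0" for y
    using nonneg_eigenvector_zero[OF sc F nonneg eig, of y] nonneg[of y] by fastforce
  then have "positive_eigenpair F (mass v) v" using eig by (simp add: positive_eigenpair_iff)
  then show ?thesis by blast
qed

lemma positive_eigenpair_root_pos:
  assumes ne: "E \<noteq> {}" and sc: "strongly_connected E" and F: "F \<in> pos_edge_funs E"
    and pair: "positive_eigenpair F \<rho> v"
  shows "\<rho> > 0"
proof -
  fix a
  obtain b where b: "(a, b) \<in> E" using strongly_connected_succ[OF ne sc] by blast
  have v: "v $ y > 0" for y using pair by (simp add: positive_eigenpair_iff)
  have "0 < F $ a $ b * v $ b" using v pos_edge_funs_pos[OF F b] by simp
  also have "\<dots> \<le> (\<Sum>y'\<in>UNIV. F $ a $ y' * v $ y')"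
    using v pos_edge_funs_nonneg[OF F] by (intro member_le_sum) (auto simp: less_imp_le)
  also have "\<dots> = \<rho> * v $ a" using pair by (simp add: positive_eigenpair_iff)
  finally show ?thesis using v[of a] by (simp add: zero_less_mult_iff)
qed

text \<open>A positive eigenvector dominates every complex one: if \<open>F u = \<mu> u\<close>, then comparing \<open>|u|\<close> with
  \<open>v\<close> at a state where \<open>|u| / v\<close> is maximal gives \<open>|\<mu>| \<le> \<rho>\<close>. So the eigenvalue of a positive
  eigenvector is the spectral radius.\<close>

lemma pf_root_eqI:
  assumes ne: "E \<noteq> {}" and sc: "strongly_connected E" and F: "F \<in> pos_edge_funs E"
    and pair: "positive_eigenpair F \<rho> v"
  shows "pf_root F = \<rho>"
  unfolding pf_root_def
proof (rule cSup_eq_maximum)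
  have v: "v $ y > 0" for y using pair by (simp add: positive_eigenpair_iff)
  have eig: "(\<Sum>y'\<in>UNIV. F $ y $ y' * v $ y') = \<rho> * v $ y" for y
    using pair by (simp add: positive_eigenpair_iff)
  have rho: "\<rho> > 0" by (rule positive_eigenpair_root_pos[OF ne sc F pair])
  have "complex_eigenvalue F (complex_of_real \<rho>)"
    unfolding complex_eigenvalue_def
  proof (intro exI conjI)
    show "(\<chi> y. complex_of_real (v $ y)) \<noteq> 0"
      using v by (simp add: vec_eq_iff less_imp_neq[symmetric])
    show "(\<chi> y y'. complex_of_real (F $ y $ y')) *v (\<chi> y. complex_of_real (v $ y)) =
        complex_of_real \<rho> *s (\<chi> y. complex_of_real (v $ y))"
      by (simp add: vec_eq_iff matrix_vector_mult_def eig
          flip: of_real_mult of_real_sum)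
  qed
  moreover have "cmod (complex_of_real \<rho>) = \<rho>" using rho by simp
  ultimately show "\<rho> \<in> {cmod \<mu> | \<mu>. complex_eigenvalue F \<mu>}"
    by (intro CollectI exI[of _ "complex_of_real \<rho>"]) simp
  fix r assume "r \<in> {cmod \<mu> | \<mu>. complex_eigenvalue F \<mu>}"
  then obtain \<mu> u where r: "r = cmod \<mu>" and "u \<noteq> 0"
    and u: "(\<chi> y y'. complex_of_real (F $ y $ y')) *v u = \<mu> *s u"
    by (auto simp: complex_eigenvalue_def)
  define q where "q y = cmod (u $ y) / v $ y" for y
  define m where "m = Max (range q)"
  have "m \<in> range q" unfolding m_def by (rule Max_in) auto
  then obtain a where a: "m = q a" by blast
  have le_m: "cmod (u $ y) \<le> m * v $ y" for y
  proof -
    have "q y \<le> m" unfolding m_def by (rule Max_ge) auto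
    then show ?thesis using v[of y] by (simp add: q_def divide_le_eq)
  qed
  have eq_m: "cmod (u $ a) = m * v $ a" using v[of a] by (simp add: a q_def)
  obtain b where "u $ b \<noteq> 0" using \<open>u \<noteq> 0\<close> by (auto simp: vec_eq_iff)
  then have "m * v $ b > 0" using le_m[of b] by (smt (verit) zero_less_norm_iff)
  then have "m > 0" using v[of b] by (simp add: zero_less_mult_iff)
  have "cmod \<mu> * (m * v $ a) = cmod (\<mu> * u $ a)" by (simp add: norm_mult eq_m)
  also have "\<mu> * u $ a = (\<Sum>y'\<in>UNIV. complex_of_real (F $ a $ y') * u $ y')"
    using u by (simp add: vec_eq_iff matrix_vector_mult_def)
  also have "cmod \<dots> \<le> (\<Sum>y'\<in>UNIV. F $ a $ y' * cmod (u $ y'))"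
    using pos_edge_funs_nonneg[OF F]
    by (intro order_trans[OF norm_sum] sum_mono) (simp add: norm_mult)
  also have "\<dots> \<le> (\<Sum>y'\<in>UNIV. F $ a $ y' * (m * v $ y'))"
    using pos_edge_funs_nonneg[OF F] le_m by (intro sum_mono mult_left_mono)
  also have "\<dots> = m * (\<Sum>y'\<in>UNIV. F $ a $ y' * v $ y')"
    by (simp add: sum_distrib_left mult_ac)
  also have "\<dots> = \<rho> * (m * v $ a)" by (simp add: eig)
  finally show "r \<le> \<rho>" using \<open>m > 0\<close> v[of a] by (simp add: r)
qed

text \<open>Subtracting the largest multiple of \<open>v\<close> that stays below \<open>w\<close> leaves a nonnegative solution
  of \<open>F z = \<rho> z\<close> that vanishes somewhere, hence everywhere.\<close>

lemma positive_eigenvector_unique: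
  fixes E :: "('y::finite \<times> 'y) set"
  assumes sc: "strongly_connected E" and F: "F \<in> pos_edge_funs E"
    and pv: "positive_eigenpair F \<rho> v" and pw: "positive_eigenpair F \<rho> w"
  shows "\<exists>m>0. w = m *s v"
proof -
  have v: "v $ y > 0" and w: "w $ y > 0" for y
    using pv pw by (simp_all add: positive_eigenpair_iff)
  define q where "q y = w $ y / v $ y" for y
  define m where "m = Min (range q)"
  have "m \<in> range q" unfolding m_def by (rule Min_in) auto
  then obtain a where a: "m = q a" by blast
  have nonneg: "(w - m *s v) $ y \<ge> 0" for y
  proof -
    have "m \<le> q y" unfolding m_def by (rule Min_le) auto
    then show ?thesis using v[of y] by (simp add: q_def le_divide_eq)
  qed
  have zero: "(w - m *s v) $ a = 0" using v[of a] by (simp add: a q_def)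
  have "F *v (w - m *s v) = \<rho> *s (w - m *s v)"
    using pv pw
    by (simp add: positive_eigenpair_def matrix_vector_mult_diff_distrib matrix_vector_mult_scaleR
        scalar_mult_eq_scaleR algebra_simps)
  then have eig: "(\<Sum>y'\<in>UNIV. F $ y $ y' * (w - m *s v) $ y') = \<rho> * (w - m *s v) $ y" for y
    by (simp add: vec_eq_iff matrix_vector_mult_def right_diff_distrib)
  have "w - m *s v = 0"
    using nonneg_eigenvector_zero[OF sc F nonneg eig zero] .
  moreover have "m > 0" using v[of a] w[of a] by (simp add: a q_def)
  ultimately show ?thesis by auto
qed

text \<open>Any positive eigenvector may be used to compute \<open>stoch\<close>, whatever vector the choice operator in
  \<open>pf_vector\<close> picks.\<close>

lemma stoch_eq:
  assumes ne: "E \<noteq> {}" and sc: "strongly_connected E" and F: "F \<in> pos_edge_funs E"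
    and pair: "positive_eigenpair F \<rho> v"
  shows "stoch F $ y $ y' = F $ y $ y' * v $ y' / (\<rho> * v $ y)"
proof -
  have root: "pf_root F = \<rho>" by (rule pf_root_eqI[OF ne sc F pair])
  have "positive_eigenpair F \<rho> (pf_vector F)"
    using pair someI_ex[of "\<lambda>v. (\<forall>y. v $ y > 0) \<and> F *v v = pf_root F *s v"]
    unfolding pf_vector_def root positive_eigenpair_def by blast
  then obtain m where "m > 0" "pf_vector F = m *s v"
    using positive_eigenvector_unique[OF sc F pair] by blast
  then show ?thesis by (simp add: stoch_def root)
qed

lemma stoch_in_stochastic_funs:
  assumes ne: "E \<noteq> {}" and sc: "strongly_connected E" and F: "F \<in> pos_edge_funs E"
  shows "stoch F \<in> stochastic_funs E"
proof -
  obtain \<rho> v where pair: "positive_eigenpair F \<rho> v"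
    using positive_eigenpair_exists[OF assms] by blast
  note eq = stoch_eq[OF assms pair]
  have v: "v $ y > 0" for y using pair by (simp add: positive_eigenpair_iff)
  have rho: "\<rho> > 0" by (rule positive_eigenpair_root_pos[OF assms pair])
  have "(\<Sum>y'\<in>UNIV. stoch F $ y $ y') = 1" for y
  proof -
    have "(\<Sum>y'\<in>UNIV. stoch F $ y $ y') = (\<Sum>y'\<in>UNIV. F $ y $ y' * v $ y') / (\<rho> * v $ y)"
      by (simp add: eq sum_divide_distrib)
    also have "\<dots> = 1"
      using pair v[of y] rho by (simp add: positive_eigenpair_iff less_imp_neq[symmetric])
    finally show ?thesis .
  qed
  then show ?thesis
    using F v rho
    by (auto simp: stochastic_funs_def pos_edge_funs_def edge_funs_def eq)
qed

lemma stoch_stochastic: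
  assumes ne: "E \<noteq> {}" and sc: "strongly_connected E" and P: "P \<in> stochastic_funs E"
  shows "stoch P = P"
proof -
  have pos: "P \<in> pos_edge_funs E" using P by (simp add: stochastic_funs_def)
  have "positive_eigenpair P 1 (\<chi> y. 1)"
    using P by (simp add: positive_eigenpair_iff stochastic_funs_def)
  from stoch_eq[OF ne sc pos this] show ?thesis by (simp add: vec_eq_iff)
qed


section \<open>Exponential families modulo the null space\<close>

lemma exp_on_pos: "exp_on E A \<in> pos_edge_funs E"
  by (auto simp: exp_on_def pos_edge_funs_def edge_funs_def)

lemma subspace_null_space: "subspace (null_space E)"
proof (rule subspaceI)
  show "0 \<in> null_space E"
    by (auto simp: null_space_def edge_funs_def intro!: exI[of _ "\<lambda>_. 0"] exI[of _ 0])
next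
  fix M N assume "M \<in> null_space E" "N \<in> null_space E"
  then obtain f c g d where
    "\<forall>(y, y') \<in> E. M $ y $ y' = f y' - f y + c" "\<forall>(y, y') \<in> E. N $ y $ y' = g y' - g y + d"
    and "M \<in> edge_funs E" "N \<in> edge_funs E"
    by (auto simp: null_space_def)
  then show "M + N \<in> null_space E"
    by (auto simp: null_space_def edge_funs_def split_beta
        intro!: exI[of _ "\<lambda>y. f y + g y"] exI[of _ "c + d"])
next
  fix r N assume "N \<in> null_space E"
  then obtain f c where "\<forall>(y, y') \<in> E. N $ y $ y' = f y' - f y + c" "N \<in> edge_funs E"
    by (auto simp: null_space_def)
  then show "r *\<^sub>R N \<in> null_space E"
    by (auto simp: null_space_def edge_funs_def split_beta right_diff_distrib distrib_left
        intro!: exI[of _ "\<lambda>y. r * f y"] exI[of _ "r * c"])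
qed

text \<open>Adding \<open>f y' - f y + c\<close> in the exponent conjugates the matrix by the diagonal matrix \<open>exp f\<close> and
  scales it by \<open>exp c\<close>; the eigenvector absorbs the one and the root absorbs the other.\<close>

lemma stoch_exp_on_add_null:
  assumes ne: "E \<noteq> {}" and sc: "strongly_connected E" and N: "N \<in> null_space E"
  shows "stoch (exp_on E (A + N)) = stoch (exp_on E A)"
proof -
  obtain f c where "\<forall>(y, y') \<in> E. N $ y $ y' = f y' - f y + c"
    using N by (auto simp: null_space_def)
  then have N_eq: "N $ y $ y' = f y' - f y + c" if "(y, y') \<in> E" for y y'
    using that by blast
  obtain \<rho> v where pair: "positive_eigenpair (exp_on E A) \<rho> v"
    using positive_eigenpair_exists[OF ne sc exp_on_pos] by blast
  have v: "v $ y > 0" for y using pair by (simp add: positive_eigenpair_iff)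
  define w :: "real ^ 'a" where "w = (\<chi> y. exp (- f y) * v $ y)"
  have entry: "exp_on E (A + N) $ y $ y' * w $ y' =
      exp (c - f y) * (exp_on E A $ y $ y' * v $ y')" for y y'
  proof (cases "(y, y') \<in> E")
    case True
    then have "A $ y $ y' + N $ y $ y' + - f y' = c - f y + A $ y $ y'" by (simp add: N_eq)
    then have "exp (A $ y $ y' + N $ y $ y') * exp (- f y') = exp (c - f y) * exp (A $ y $ y')"
      unfolding exp_add[symmetric] by simp
    then show ?thesis using True by (simp add: exp_on_def w_def)
  qed (simp add: exp_on_def)
  have "positive_eigenpair (exp_on E (A + N)) (exp c * \<rho>) w"
    using pair unfolding positive_eigenpair_iff entry sum_distrib_left[symmetric]
    by (simp add: w_def exp_diff exp_minus divide_inverse mult_ac)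
  note new = stoch_eq[OF ne sc exp_on_pos this]
  have "stoch (exp_on E (A + N)) $ y $ y' = stoch (exp_on E A) $ y $ y'" for y y'
    unfolding new entry stoch_eq[OF ne sc exp_on_pos pair]
    by (simp add: w_def exp_diff exp_minus divide_inverse mult_ac)
  then show ?thesis by (simp add: vec_eq_iff)
qed

text \<open>The generators are a basis of the part of \<open>U\<close> that is orthogonal to \<open>M\<close>: a combination of
  them that lies in \<open>M\<close> is orthogonal to itself.\<close>

lemma complement_basis_exists:
  fixes U M :: "'a::euclidean_space set"
  assumes U: "subspace U" and M: "subspace M" and "M \<subseteq> U"
  shows "\<exists>(d::nat) G. (\<forall>i\<in>{1..d}. G i \<in> U) \<and>
    (\<forall>a. (\<Sum>i=1..d. a i *\<^sub>R G i) \<in> M \<longrightarrow> (\<forall>i\<in>{1..d}. a i = 0)) \<and>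
    (\<forall>u\<in>U. \<exists>a. u - (\<Sum>i=1..d. a i *\<^sub>R G i) \<in> M)"
proof -
  define C where "C = {u \<in> U. \<forall>m\<in>M. orthogonal u m}"
  have C: "subspace C"
    using U by (auto simp: C_def subspace_def orthogonal_clauses)
  obtain B where B: "B \<subseteq> C" "independent B" "span B = C"
    using basis_exists[of C] C by (metis span_subspace)
  have fin: "finite B" using B(2) by (rule independent_imp_finite)
  obtain G where G: "bij_betw G {1..card B} B"
    using ex_bij_betw_nat_finite_1[OF fin] by blast
  have reindex: "(\<Sum>i=1..card B. c (G i) *\<^sub>R G i) = (\<Sum>b\<in>B. c b *\<^sub>R b)" for c
    using sum.reindex_bij_betw[OF G, of "\<lambda>b. c b *\<^sub>R b"] .
  have G_in: "G i \<in> C" if "i \<in> {1..card B}" for i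
    using that G B(1) by (auto simp: bij_betw_def)
  have independent: "a i = 0"
    if "(\<Sum>i=1..card B. a i *\<^sub>R G i) \<in> M" "i \<in> {1..card B}" for a i
  proof -
    have "(\<Sum>i=1..card B. a i *\<^sub>R G i) \<in> C"
      using C G_in by (intro subspace_sum subspace_mul) auto
    then have zero: "(\<Sum>i=1..card B. a i *\<^sub>R G i) = 0"
      using that(1) by (auto simp: C_def orthogonal_self)
    define c where "c b = a (inv_into {1..card B} G b)" for b
    have c: "c (G j) = a j" if "j \<in> {1..card B}" for j
      using that G by (simp add: c_def bij_betw_def inv_into_f_f)
    have "(\<Sum>b\<in>B. c b *\<^sub>R b) = 0"
      unfolding reindex[of c, symmetric] zero[symmetric] by (intro sum.cong refl) (simp add: c)
    moreover have "G i \<in> B" using that(2) G by (auto simp: bij_betw_def)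
    ultimately have "c (G i) = 0"
      using independentD[OF B(2) fin subset_refl, of c] by blast
    then show ?thesis using c[OF that(2)] by simp
  qed
  have spanning: "\<exists>a. u - (\<Sum>i=1..card B. a i *\<^sub>R G i) \<in> M" if u: "u \<in> U" for u
  proof -
    obtain m z where mz: "m \<in> span M" "\<And>w. w \<in> span M \<Longrightarrow> orthogonal z w" "u = m + z"
      using orthogonal_subspace_decomp_exists[of M u] by blast
    have m: "m \<in> M" using mz(1) M by (simp add: span_eq_iff[THEN iffD2])
    have "u - m \<in> U" using U u m \<open>M \<subseteq> U\<close> by (intro subspace_diff) auto
    then have "z \<in> C" using mz by (auto simp: C_def span_base)
    then obtain c where "z = (\<Sum>b\<in>B. c b *\<^sub>R b)"
      using B(3) span_finite[OF fin] by auto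
    then have "u - (\<Sum>i=1..card B. c (G i) *\<^sub>R G i) = m" using mz(3) unfolding reindex by simp
    then show ?thesis using m by (intro exI[of _ "\<lambda>i. c (G i)"]) simp
  qed
  show ?thesis
  proof (intro exI conjI)
    show "\<forall>i\<in>{1..card B}. G i \<in> U" using G_in by (auto simp: C_def)
    show "\<forall>a. (\<Sum>i=1..card B. a i *\<^sub>R G i) \<in> M \<longrightarrow> (\<forall>i\<in>{1..card B}. a i = 0)"
      using independent by blast
    show "\<forall>u\<in>U. \<exists>a. u - (\<Sum>i=1..card B. a i *\<^sub>R G i) \<in> M"
      using spanning by blast
  qed
qed


section \<open>Lumpability as a linear condition on entries\<close>

text \<open>Only pairs of distinct rows are compared, so that the entries in the row of a singleton fibre
  stay independent of each other.\<close>

definition tied_funs :: "('y::finite \<times> 'y) set \<Rightarrow> ('y \<Rightarrow> 'x) \<Rightarrow> (real ^ 'y ^ 'y) set" where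
  "tied_funs E \<kappa> = {A \<in> edge_funs E.
     \<forall>y1 z1 y2 z2. (y1, z1) \<in> E \<and> (y2, z2) \<in> E \<and> y1 \<noteq> y2 \<and> \<kappa> y1 = \<kappa> y2 \<and> \<kappa> z1 = \<kappa> z2 \<longrightarrow>
       A $ y1 $ z1 = A $ y2 $ z2}"

lemma tied_funsD:
  "A \<in> tied_funs E \<kappa> \<Longrightarrow> (y1, z1) \<in> E \<Longrightarrow> (y2, z2) \<in> E \<Longrightarrow> y1 \<noteq> y2 \<Longrightarrow> \<kappa> y1 = \<kappa> y2 \<Longrightarrow>
     \<kappa> z1 = \<kappa> z2 \<Longrightarrow> A $ y1 $ z1 = A $ y2 $ z2"
  unfolding tied_funs_def by blast

lemma subspace_tied_funs: "subspace (tied_funs E \<kappa>)"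
proof (rule subspaceI)
  show "0 \<in> tied_funs E \<kappa>" by (simp add: tied_funs_def edge_funs_def)
next
  fix A B assume "A \<in> tied_funs E \<kappa>" "B \<in> tied_funs E \<kappa>"
  then show "A + B \<in> tied_funs E \<kappa>"
    unfolding tied_funs_def edge_funs_def mem_Collect_eq vector_add_component
    by (metis add_0)
next
  fix r A assume "A \<in> tied_funs E \<kappa>"
  then show "r *\<^sub>R A \<in> tied_funs E \<kappa>"
    unfolding tied_funs_def edge_funs_def mem_Collect_eq vector_scaleR_component
    by (metis scaleR_zero_right)
qed

lemma exp_on_tied: "A \<in> tied_funs E \<kappa> \<Longrightarrow> exp_on E A \<in> tied_funs E \<kappa>"
  by (auto simp: tied_funs_def edge_funs_def exp_on_def)

lemma tied_is_exp_on_tied: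
  assumes "P \<in> pos_edge_funs E" "P \<in> tied_funs E \<kappa>"
  shows "\<exists>A\<in>tied_funs E \<kappa>. exp_on E A = P"
proof
  define A where "A = (\<chi> y y'. if (y, y') \<in> E then ln (P $ y $ y') else 0)"
  show "A \<in> tied_funs E \<kappa>"
    using assms(2) by (auto simp: tied_funs_def edge_funs_def A_def)
  show "exp_on E A = P"
    using assms(1) pos_edge_funs_pos[OF assms(1)]
    by (auto simp: vec_eq_iff exp_on_def A_def pos_edge_funs_def edge_funs_def)
qed

lemma unique_edge_into_fibre:
  fixes E :: "('y::finite \<times> 'y) set"
  assumes no_merge: "\<not> (\<exists>x x'. multi_row_merging_block E \<kappa> (x, x'))"
    and "y1 \<noteq> y2" "\<kappa> y1 = \<kappa> y2" "(y1, z) \<in> E" "(y1, z') \<in> E" "\<kappa> z = \<kappa> z'"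
  shows "z = z'"
proof (rule ccontr)
  assume "z \<noteq> z'"
  have "card {(y1, z), (y1, z')} \<le> card {(a, b) \<in> E. a = y1 \<and> b \<in> fibre \<kappa> (\<kappa> z)}"
    using assms by (intro card_mono) (auto simp: fibre_def)
  then have "1 < card {(a, b) \<in> E. a = y1 \<and> b \<in> fibre \<kappa> (\<kappa> z)}" using \<open>z \<noteq> z'\<close> by simp
  then have "merging_block E \<kappa> (\<kappa> y1, \<kappa> z)"
    using assms(4) by (auto simp: merging_block_def lumped_edges_def fibre_def)
  moreover have "card {y1, y2} \<le> card (fibre \<kappa> (\<kappa> y1))"
    using assms by (intro card_mono) (auto simp: fibre_def)
  ultimately have "multi_row_merging_block E \<kappa> (\<kappa> y1, \<kappa> z)"
    using \<open>y1 \<noteq> y2\<close> by (simp add: multi_row_merging_block_def)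
  then show False using no_merge by blast
qed

lemma row_mass_fibre_single:
  assumes no_merge: "\<not> (\<exists>x x'. multi_row_merging_block E \<kappa> (x, x'))"
    and F: "F \<in> edge_funs E" and "y1 \<noteq> y2" "\<kappa> y1 = \<kappa> y2" "(y1, z) \<in> E"
  shows "row_mass F y1 (fibre \<kappa> (\<kappa> z)) = F $ y1 $ z"
proof -
  have "F $ y1 $ z' = 0" if "\<kappa> z' = \<kappa> z" "z' \<noteq> z" for z'
    using F unique_edge_into_fibre[OF assms(1,3-5), of z'] that
    by (auto simp: edge_funs_def)
  then have "row_mass F y1 (fibre \<kappa> (\<kappa> z)) = (\<Sum>z'\<in>{z}. F $ y1 $ z')"
    unfolding row_mass_def by (intro sum.mono_neutral_right) (auto simp: fibre_def)
  then show ?thesis by simp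
qed

lemma lumpable_row_mass_eq:
  "P \<in> lumpable_funs E \<kappa> \<Longrightarrow> (x, x') \<in> lumped_edges E \<kappa> \<Longrightarrow> \<kappa> y1 = x \<Longrightarrow> \<kappa> y2 = x \<Longrightarrow>
     row_mass P y1 (fibre \<kappa> x') = row_mass P y2 (fibre \<kappa> x')"
  unfolding lumpable_funs_def fibre_def by blast

text \<open>One row of a lumpable chain puts positive mass on the block, so every row of the fibre does.\<close>

lemma lumpable_edge_into_fibre:
  assumes P: "P \<in> lumpable_funs E \<kappa>" and xx': "(x, x') \<in> lumped_edges E \<kappa>" and y: "\<kappa> y = x"
  shows "\<exists>z. (y, z) \<in> E \<and> \<kappa> z = x'"
proof (rule ccontr)
  assume none: "\<not> ?thesis"
  have pos: "P \<in> pos_edge_funs E" using P by (simp add: lumpable_funs_def stochastic_funs_def)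
  obtain a b where ab: "(a, b) \<in> E" "\<kappa> a = x" "\<kappa> b = x'"
    using xx' by (auto simp: lumped_edges_def)
  have "0 < P $ a $ b" by (rule pos_edge_funs_pos[OF pos ab(1)])
  also have "\<dots> \<le> row_mass P a (fibre \<kappa> x')"
    unfolding row_mass_def using ab pos_edge_funs_nonneg[OF pos]
    by (intro member_le_sum) (auto simp: fibre_def)
  also have "\<dots> = row_mass P y (fibre \<kappa> x')"
    using lumpable_row_mass_eq[OF P xx' ab(2) y] .
  also have "\<dots> = 0"
    using none pos unfolding row_mass_def
    by (intro sum.neutral) (auto simp: fibre_def pos_edge_funs_def edge_funs_def)
  finally show False by simp
qed

text \<open>Here the nonemptiness of the set of lumpable chains enters: it guarantees that rows of one fibre
  reach the same fibres, which the tied equations do not see.\<close>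

lemma tied_row_mass_eq:
  assumes no_merge: "\<not> (\<exists>x x'. multi_row_merging_block E \<kappa> (x, x'))"
    and lumpable: "lumpable_funs E \<kappa> \<noteq> {}"
    and F: "F \<in> tied_funs E \<kappa>" and y: "\<kappa> y1 = \<kappa> y2"
  shows "row_mass F y1 (fibre \<kappa> x') = row_mass F y2 (fibre \<kappa> x')"
proof (cases "y1 = y2 \<or> (\<kappa> y1, x') \<notin> lumped_edges E \<kappa>")
  case True
  have edge: "F \<in> edge_funs E" using F by (simp add: tied_funs_def)
  have "row_mass F a (fibre \<kappa> x') = 0" if "(\<kappa> a, x') \<notin> lumped_edges E \<kappa>" for a
    using that edge unfolding row_mass_def
    by (intro sum.neutral) (auto simp: fibre_def edge_funs_def lumped_edges_def)
  then show ?thesis using True y by auto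
next
  case False
  have edge: "F \<in> edge_funs E" using F by (simp add: tied_funs_def)
  obtain P where P: "P \<in> lumpable_funs E \<kappa>" using lumpable by blast
  obtain z1 z2 where z: "(y1, z1) \<in> E" "\<kappa> z1 = x'" "(y2, z2) \<in> E" "\<kappa> z2 = x'"
    using lumpable_edge_into_fibre[OF P, of "\<kappa> y1" x'] False y by metis
  have "row_mass F y1 (fibre \<kappa> x') = F $ y1 $ z1"
    using row_mass_fibre_single[OF no_merge edge _ y z(1)] False z(2) by auto
  also have "\<dots> = F $ y2 $ z2"
    using tied_funsD[OF F z(1,3)] False y z by simp
  also have "\<dots> = row_mass F y2 (fibre \<kappa> x')"
    using row_mass_fibre_single[OF no_merge edge _ y[symmetric] z(3)] False z(4) by auto
  finally show ?thesis .
qed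

lemma lumpable_iff_tied:
  assumes no_merge: "\<not> (\<exists>x x'. multi_row_merging_block E \<kappa> (x, x'))"
    and lumpable: "lumpable_funs E \<kappa> \<noteq> {}"
  shows "P \<in> lumpable_funs E \<kappa> \<longleftrightarrow> P \<in> stochastic_funs E \<and> P \<in> tied_funs E \<kappa>"
proof (intro iffI conjI)
  assume P: "P \<in> lumpable_funs E \<kappa>"
  then show "P \<in> stochastic_funs E" by (simp add: lumpable_funs_def)
  then have edge: "P \<in> edge_funs E" by (simp add: stochastic_funs_def pos_edge_funs_def)
  have "P $ y1 $ z1 = P $ y2 $ z2"
    if e: "(y1, z1) \<in> E" "(y2, z2) \<in> E" "y1 \<noteq> y2" "\<kappa> y1 = \<kappa> y2" "\<kappa> z1 = \<kappa> z2" for y1 z1 y2 z2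
  proof -
    have "(\<kappa> y1, \<kappa> z1) \<in> lumped_edges E \<kappa>" using e by (auto simp: lumped_edges_def)
    then have "row_mass P y1 (fibre \<kappa> (\<kappa> z1)) = row_mass P y2 (fibre \<kappa> (\<kappa> z1))"
      by (rule lumpable_row_mass_eq[OF P]) (simp_all add: e(4))
    then show ?thesis
      using row_mass_fibre_single[OF no_merge edge e(3,4,1)]
        row_mass_fibre_single[OF no_merge edge e(3)[symmetric] e(4)[symmetric] e(2)] e(5)
      by simp
  qed
  then show "P \<in> tied_funs E \<kappa>" using edge unfolding tied_funs_def by blast
next
  assume P: "P \<in> stochastic_funs E \<and> P \<in> tied_funs E \<kappa>"
  have "row_mass P y1 (fibre \<kappa> x') = row_mass P y2 (fibre \<kappa> x')"
    if "y1 \<in> fibre \<kappa> x" "y2 \<in> fibre \<kappa> x" for x x' y1 y2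
    using that P by (intro tied_row_mass_eq[OF no_merge lumpable]) (auto simp: fibre_def)
  then show "P \<in> lumpable_funs E \<kappa>"
    using P unfolding lumpable_funs_def by blast
qed


section \<open>Lifting the Perron vector of the lumped matrix\<close>

lemma strongly_connected_lumped:
  assumes sc: "strongly_connected E" and "surj \<kappa>"
  shows "strongly_connected (lumped_edges E \<kappa>)"
  unfolding strongly_connected_def
proof (intro allI)
  fix x x'
  obtain y y' where y: "x = \<kappa> y" "x' = \<kappa> y'" using \<open>surj \<kappa>\<close> by (metis surjD)
  have "(y, y') \<in> E\<^sup>*" using sc by (simp add: strongly_connected_def)
  then have "(\<kappa> y, \<kappa> y') \<in> (lumped_edges E \<kappa>)\<^sup>*"
  proof (induction rule: rtrancl_induct)
    case (step a b)
    have "(\<kappa> a, \<kappa> b) \<in> lumped_edges E \<kappa>" using step.hyps(2) by (auto simp: lumped_edges_def)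
    then show ?case using step.IH by (rule rtrancl_into_rtrancl[rotated])
  qed simp
  then show "(x, x') \<in> (lumped_edges E \<kappa>)\<^sup>*" by (simp add: y)
qed

text \<open>If rows of one fibre have equal masses on every fibre, then \<open>F (v \<circ> \<kappa>) = (Q v) \<circ> \<kappa>\<close> for the
  matrix \<open>Q\<close> of these masses, so a Perron vector of \<open>Q\<close> lifts to one of \<open>F\<close>.\<close>

lemma fibre_constant_eigenpair_exists:
  fixes E :: "('y::finite \<times> 'y) set" and \<kappa> :: "'y \<Rightarrow> 'x::finite"
  assumes ne: "E \<noteq> {}" and sc: "strongly_connected E" and surj: "surj \<kappa>"
    and F: "F \<in> pos_edge_funs E"
    and mass: "\<And>y1 y2 x'. \<kappa> y1 = \<kappa> y2 \<Longrightarrow>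
      row_mass F y1 (fibre \<kappa> x') = row_mass F y2 (fibre \<kappa> x')"
  shows "\<exists>\<rho> v. positive_eigenpair F \<rho> (\<chi> y. v (\<kappa> y))"
proof -
  define Q :: "real ^ 'x ^ 'x" where "Q = (\<chi> x x'. row_mass F (inv \<kappa> x) (fibre \<kappa> x'))"
  have Q: "Q $ \<kappa> y $ x' = row_mass F y (fibre \<kappa> x')" for y x'
    using mass[of "inv \<kappa> (\<kappa> y)" y x'] surj by (simp add: Q_def surj_f_inv_f)
  have "Q \<in> pos_edge_funs (lumped_edges E \<kappa>)"
    unfolding pos_edge_funs_def edge_funs_def mem_Collect_eq
  proof (intro conjI allI impI ballI, safe)
    fix x x' assume no_edge: "(x, x') \<notin> lumped_edges E \<kappa>"
    obtain y where y: "x = \<kappa> y" using surj by (metis surjD)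
    have "row_mass F y (fibre \<kappa> x') = 0"
      using F no_edge y unfolding row_mass_def
      by (intro sum.neutral) (auto simp: fibre_def pos_edge_funs_def edge_funs_def lumped_edges_def)
    then show "Q $ x $ x' = 0" by (simp add: y Q)
  next
    fix x x' assume "(x, x') \<in> lumped_edges E \<kappa>"
    then obtain a b where ab: "(a, b) \<in> E" "x = \<kappa> a" "x' = \<kappa> b"
      by (auto simp: lumped_edges_def)
    have "0 < F $ a $ b" by (rule pos_edge_funs_pos[OF F ab(1)])
    also have "\<dots> \<le> row_mass F a (fibre \<kappa> x')"
      unfolding row_mass_def using ab pos_edge_funs_nonneg[OF F]
      by (intro member_le_sum) (auto simp: fibre_def)
    finally show "Q $ x $ x' > 0" by (simp add: ab Q)
  qed
  moreover have "lumped_edges E \<kappa> \<noteq> {}" using ne by (auto simp: lumped_edges_def)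
  ultimately obtain \<rho> v where v: "positive_eigenpair Q \<rho> v"
    using positive_eigenpair_exists[OF _ strongly_connected_lumped[OF sc surj]] by blast
  have "(\<Sum>y'\<in>UNIV. F $ y $ y' * v $ \<kappa> y') = \<rho> * v $ \<kappa> y" for y
  proof -
    have "(\<Sum>y'\<in>UNIV. F $ y $ y' * v $ \<kappa> y') =
        (\<Sum>x'\<in>UNIV. \<Sum>y'\<in>fibre \<kappa> x'. F $ y $ y' * v $ \<kappa> y')"
      using sum.group[of UNIV UNIV \<kappa> "\<lambda>y'. F $ y $ y' * v $ \<kappa> y'"]
      by (simp add: fibre_def vimage_def)
    also have "\<dots> = (\<Sum>x'\<in>UNIV. Q $ \<kappa> y $ x' * v $ x')"
      unfolding Q row_mass_def sum_distrib_right
      by (intro sum.cong refl) (simp add: fibre_def)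
    also have "\<dots> = \<rho> * v $ \<kappa> y" using v by (simp add: positive_eigenpair_iff)
    finally show ?thesis .
  qed
  then have "positive_eigenpair F \<rho> (\<chi> y. v $ \<kappa> y)"
    using v by (simp add: positive_eigenpair_iff)
  then show ?thesis by (intro exI[of _ \<rho>] exI[of _ "($) v"])
qed

lemma stoch_tied_lumpable:
  fixes E :: "('y::finite \<times> 'y) set" and \<kappa> :: "'y \<Rightarrow> 'x::finite"
  assumes ne: "E \<noteq> {}" and sc: "strongly_connected E" and surj: "surj \<kappa>"
    and no_merge: "\<not> (\<exists>x x'. multi_row_merging_block E \<kappa> (x, x'))"
    and lumpable: "lumpable_funs E \<kappa> \<noteq> {}"
    and F: "F \<in> pos_edge_funs E" and tied: "F \<in> tied_funs E \<kappa>"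
  shows "stoch F \<in> lumpable_funs E \<kappa>"
proof -
  obtain \<rho> v where "positive_eigenpair F \<rho> (\<chi> y. v (\<kappa> y))"
    using fibre_constant_eigenpair_exists[OF ne sc surj F
        tied_row_mass_eq[OF no_merge lumpable tied]] by blast
  from stoch_eq[OF ne sc F this]
  have eq: "stoch F $ y $ y' = F $ y $ y' * v (\<kappa> y') / (\<rho> * v (\<kappa> y))" for y y' by simp
  have "stoch F \<in> tied_funs E \<kappa>"
    using tied unfolding tied_funs_def edge_funs_def mem_Collect_eq eq
    by (metis mult_zero_left div_0)
  then show ?thesis
    using stoch_in_stochastic_funs[OF ne sc F] lumpable_iff_tied[OF no_merge lumpable] by blast
qed


section \<open>The e-family\<close>

theorem corollary4p1:
  fixes E :: "('y::finite \<times> 'y) set" and \<kappa> :: "'y \<Rightarrow> 'x::finite"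
  assumes "E \<noteq> {}"
    and "strongly_connected E"
    and "surj \<kappa>"
    and "1 < CARD('x)" and "CARD('x) < CARD('y)"
    and "lumpable_funs E \<kappa> \<noteq> {}"
    and "\<not> (\<exists>x x'. multi_row_merging_block E \<kappa> (x, x'))"
  shows "e_family E (lumpable_funs E \<kappa>)"
proof -
  note ne = assms(1) and sc = assms(2) and iff = lumpable_iff_tied[OF assms(7,6)]
  let ?U = "tied_funs E \<kappa>"
  let ?M = "tied_funs E \<kappa> \<inter> null_space E"
  have M: "subspace ?M"
    by (intro subspace_inter subspace_tied_funs subspace_null_space)
  obtain d and G :: "nat \<Rightarrow> real ^ 'y ^ 'y"
    where G: "\<forall>i\<in>{1..d}. G i \<in> ?U"
      and indep: "\<forall>a. (\<Sum>i=1..d. a i *\<^sub>R G i) \<in> ?M \<longrightarrow> (\<forall>i\<in>{1..d}. a i = 0)"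
      and spanning: "\<forall>A\<in>?U. \<exists>a. A - (\<Sum>i=1..d. a i *\<^sub>R G i) \<in> ?M"
    using complement_basis_exists[OF subspace_tied_funs M Int_lower1] by blast
  have comb: "(\<Sum>i=1..d. \<theta> i *\<^sub>R G i) \<in> ?U" for \<theta>
    using G by (intro subspace_sum subspace_mul subspace_tied_funs) auto
  have "lumpable_funs E \<kappa> =
      {stoch (exp_on E (0 + (\<Sum>i=1..d. \<theta> i *\<^sub>R G i))) | \<theta> :: nat \<Rightarrow> real. True}"
  proof (intro equalityI subsetI)
    fix P assume P: "P \<in> lumpable_funs E \<kappa>"
    then have stoc: "P \<in> stochastic_funs E" and tied: "P \<in> ?U" by (auto simp: iff)
    then obtain A where A: "A \<in> ?U" "exp_on E A = P"
      using tied_is_exp_on_tied[of P E \<kappa>] by (auto simp: stochastic_funs_def)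
    obtain \<theta> where "A - (\<Sum>i=1..d. \<theta> i *\<^sub>R G i) \<in> ?M" using spanning A(1) by blast
    then have "stoch (exp_on E A) = stoch (exp_on E (\<Sum>i=1..d. \<theta> i *\<^sub>R G i))"
      using stoch_exp_on_add_null[OF ne sc, of "A - (\<Sum>i=1..d. \<theta> i *\<^sub>R G i)"
          "\<Sum>i=1..d. \<theta> i *\<^sub>R G i"] by simp
    then have "P = stoch (exp_on E (0 + (\<Sum>i=1..d. \<theta> i *\<^sub>R G i)))"
      using stoch_stochastic[OF ne sc stoc] A(2) by simp
    then show "P \<in> {stoch (exp_on E (0 + (\<Sum>i=1..d. \<theta> i *\<^sub>R G i))) | \<theta> :: nat \<Rightarrow> real. True}"
      by blast
  next
    fix P assume "P \<in> {stoch (exp_on E (0 + (\<Sum>i=1..d. \<theta> i *\<^sub>R G i))) | \<theta> :: nat \<Rightarrow> real. True}"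
    then obtain \<theta> where P: "P = stoch (exp_on E (\<Sum>i=1..d. \<theta> i *\<^sub>R G i))" by auto
    show "P \<in> lumpable_funs E \<kappa>"
      unfolding P
      by (intro stoch_tied_lumpable assms(1-3,6,7) exp_on_pos exp_on_tied comb)
  qed
  moreover have "lumpable_funs E \<kappa> \<subseteq> stochastic_funs E" by (auto simp: lumpable_funs_def)
  moreover have "independent_mod_null E d G"
    using indep comb by (auto simp: independent_mod_null_def)
  moreover have "\<forall>i\<in>{1..d}. G i \<in> edge_funs E" using G by (auto simp: tied_funs_def)
  moreover have "0 \<in> edge_funs E" by (simp add: edge_funs_def)
  ultimately show ?thesis unfolding e_family_def e_family_of_dim_def by blast
qed

end
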